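(* Let $z \in \mathbb{R}^d$, $\lambda \ge 0$, $\phi(x) = \frac{1}{2}\|x - z\|_2^2 + \lambda\left(\|x\|_1 - \|x\|_2\right)$ for $x\in\mathbb{R}^d$, and let $x^* = \operatorname{prox}_{\lambda\|\cdot\|_{1\text{-}2}}(z) = \arg\min_{x\in\mathbb{R}^d}\phi(x)$. Let $w = [w_i] \in \mathbb{R}^d$, with $w_i = \operatorname{sign}(z_i)\max(|z_i| - \lambda, 0)$. (i) If $w = 0$, then $x^*_j = z_j$ for $j = \arg\max_{i=1,\dots,d}|z_i|$, and $x^*_i = 0$ otherwise (i.e., for $i \neq j$). (ii) If $w \neq 0$, then $x^* = \left(1 + \frac{\lambda}{\|w\|_2}\right) w$.
   Context: $\|x\|_1 = \sum_{i=1}^d |x_i|$ and $\|x\|_2 = (\sum_{i=1}^d x_i^2)^{1/2}$. For a scalar $t$, $\operatorname{sign}(t) = 1$ if $t>0$, $-1$ if $t<0$, and $0$ otherwise. The regularizer is $\|x\|_{1\text{-}2} = \|x\|_1 - \|x\|_2$, and $x^*$ denotes the solution of its proximal step at $z$.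
   Formalization: In (i), if λ>0, max|z_i|=λ and the maximum is attained at several indices, other minimizers exist (e.g. z=(λ,λ)), so there only minimality of the stated vector is claimed, for each maximizing j; otherwise every minimizer has the stated form for some maximizing j. *)

theory Defs
  imports "HOL-Analysis.Analysis"
begin

definition norm1 :: "real ^ 'd \<Rightarrow> real" where
  "norm1 x = (\<Sum>i\<in>UNIV. \<bar>x $ i\<bar>)"

text \<open>The library's \<^const>\<open>norm\<close> on \<open>real ^ 'd\<close> is the Euclidean norm.\<close>

definition norm12 :: "real ^ 'd \<Rightarrow> real" where
  "norm12 x = norm1 x - norm x"

text \<open>The proximal step is a set, because the objective need not be convex
  and may have several global minimizers.\<close>

definition prox :: "(real ^ 'd \<Rightarrow> real) \<Rightarrow> real ^ 'd \<Rightarrow> (real ^ 'd) set" where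
  "prox g z = {x. is_arg_min (\<lambda>y. 1/2 * (norm (y - z))\<^sup>2 + g y) (\<lambda>_. True) x}"

definition argmax_abs :: "real ^ 'd \<Rightarrow> 'd set" where
  "argmax_abs z = {j. is_arg_max (\<lambda>i. \<bar>z $ i\<bar>) (\<lambda>_. True) j}"

definition keep_coord :: "real ^ 'd \<Rightarrow> 'd \<Rightarrow> real ^ 'd" where
  "keep_coord z j = (\<chi> i. if i = j then z $ j else 0)"

end

(* Expanding the square, the objective is ||x||^2/2 - lam ||x|| + ||z||^2/2 plus the separable
   term S(x) = sum_i (lam |x_i| - x_i z_i). If w is nonzero, S(x) >= -<x, w> coordinatewise, so
   Cauchy-Schwarz leaves a quadratic in ||x|| minimal at ||w|| + lam, and equality forces x to be
   parallel to w. If w = 0 and M = max |z_i| <= lam, then S(x) >= (lam - M) ||x||_1 >= (lam - M) ||x||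
   leaves a quadratic minimal at M; equality forces x to live on the argmax coordinates and, when
   M < lam, the equality of the 1- and 2-norms forces a single coordinate. *)
theory Submission
  imports Defs
begin

lemma mem_prox_iff:
  "x \<in> prox g z \<longleftrightarrow>
    (\<forall>y. 1/2 * (norm (x - z))\<^sup>2 + g x \<le> 1/2 * (norm (y - z))\<^sup>2 + g y)"
  by (auto simp: prox_def is_arg_min_def not_less)

lemma mem_argmax_abs_iff: "j \<in> argmax_abs z \<longleftrightarrow> (\<forall>i. \<bar>z $ i\<bar> \<le> \<bar>z $ j\<bar>)"
  by (auto simp: argmax_abs_def is_arg_max_def not_less)

lemma argmax_abs_nonempty:
  fixes z :: "real ^ 'd"
  shows "\<exists>j. j \<in> argmax_abs z"
proof -
  let ?A = "range (\<lambda>i. \<bar>z $ i\<bar>)"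
  have "Max ?A \<in> ?A" by (rule Max_in) auto
  then obtain j where "Max ?A = \<bar>z $ j\<bar>" by blast
  moreover have "\<bar>z $ i\<bar> \<le> Max ?A" for i by (rule Max_ge) auto
  ultimately show ?thesis by (auto simp: mem_argmax_abs_iff)
qed

lemma norm_le_norm1: "norm x \<le> norm1 x"
  unfolding norm1_def by (rule norm_le_l1_cart)

lemma prox_objective_expand:
  fixes x z :: "real ^ 'd"
  shows "1/2 * (norm (x - z))\<^sup>2 + lam * norm12 x =
    (norm x)\<^sup>2 / 2 - lam * norm x + (\<Sum>i\<in>UNIV. lam * \<bar>x $ i\<bar> - x $ i * z $ i) + (norm z)\<^sup>2 / 2"
proof -
  have "(\<Sum>i\<in>UNIV. lam * \<bar>x $ i\<bar> - x $ i * z $ i) = lam * norm1 x - x \<bullet> z"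
    by (simp add: sum_subtractf norm1_def sum_distrib_left inner_vec_def)
  moreover have "(norm (x - z))\<^sup>2 = (norm x)\<^sup>2 - 2 * (x \<bullet> z) + (norm z)\<^sup>2"
    by (simp add: power2_norm_eq_inner inner_diff inner_commute algebra_simps)
  ultimately show ?thesis
    by (simp add: norm12_def algebra_simps)
qed

text \<open>Erasing entry i from x leaves y with |x_i| + ||y||_2 <= ||x||_2, while Pythagoras gives
  ||x||_2^2 = x_i^2 + ||y||_2^2. Squaring the former leaves 2 |x_i| ||y||_2 <= 0, hence y =
  0.\<close>

lemma norm1_eq_norm_imp_single_coordinate:
  fixes x :: "real ^ 'd"
  assumes eq: "norm1 x = norm x" and i: "x $ i \<noteq> 0" and k: "k \<noteq> i"
  shows "x $ k = 0"
proof -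
  define y :: "real ^ 'd" where "y = x - axis i (x $ i)"
  have y_nth: "y $ l = (if l = i then 0 else x $ l)" for l
    by (simp add: y_def axis_def)
  have "norm1 x = \<bar>x $ i\<bar> + norm1 y"
    unfolding norm1_def by (simp add: sum.remove[of UNIV i] y_nth)
  then have le: "\<bar>x $ i\<bar> + norm y \<le> norm x"
    using norm_le_norm1[of y] eq by simp
  have "(norm x)\<^sup>2 = (x $ i)\<^sup>2 + (norm y)\<^sup>2"
    unfolding power2_norm_eq_inner inner_vec_def
    by (simp add: sum.remove[of UNIV i] y_nth power2_eq_square)
  moreover have "(\<bar>x $ i\<bar> + norm y)\<^sup>2 \<le> (norm x)\<^sup>2"
    using le by (intro power_mono) auto
  ultimately have "\<bar>x $ i\<bar> * norm y \<le> 0"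
    by (simp add: power2_sum mult.commute)
  then have "y = 0"
    using i by (simp add: mult_le_0_iff)
  then show ?thesis using y_nth[of k] k by simp
qed

lemma norm_axis:
  fixes c :: real
  shows "norm (axis i c) = \<bar>c\<bar>"
  by (simp add: norm_eq_sqrt_inner inner_axis_axis)

lemma keep_coord_eq_axis: "keep_coord z j = axis j (z $ j)"
  by (simp add: keep_coord_def axis_def vec_eq_iff)

lemma norm_keep_coord: "norm (keep_coord z j) = \<bar>z $ j\<bar>"
  by (simp add: keep_coord_eq_axis norm_axis)

lemma norm1_keep_coord: "norm1 (keep_coord z j) = \<bar>z $ j\<bar>"
  by (simp add: norm1_def keep_coord_def if_distrib cong: if_cong)

lemma prox_norm12_large:
  fixes z w :: "real ^ 'd"
  assumes lam: "lam \<ge> 0"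
    and w: "w = (\<chi> i. sgn (z $ i) * max (\<bar>z $ i\<bar> - lam) 0)"
    and w0: "w \<noteq> 0"
  shows "prox (\<lambda>x. lam * norm12 x) z = {(1 + lam / norm w) *\<^sub>R w}"
proof -
  define S where "S x = (\<Sum>i\<in>UNIV. lam * \<bar>x $ i\<bar> - x $ i * z $ i)" for x :: "real ^ 'd"
  define obj where "obj x = 1/2 * (norm (x - z))\<^sup>2 + lam * norm12 x" for x
  define c where "c = 1 + lam / norm w"
  \<comment> \<open>The quadratic t^2/2 - (||w|| + lam) t is least at t = ||w|| + lam, with value
    -(||w|| + lam)^2/2; adding the constant ||z||^2/2 gives the candidate minimum.\<close>
  define m where "m = (norm z)\<^sup>2 / 2 - (norm w + lam)\<^sup>2 / 2"
  have nw: "norm w > 0" using w0 by simp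
  have obj: "obj x = (norm x)\<^sup>2 / 2 - lam * norm x + S x + (norm z)\<^sup>2 / 2" for x
    unfolding obj_def S_def by (rule prox_objective_expand)
  \<comment> \<open>Coordinatewise: past the threshold, w_i = z_i - lam sgn(z_i) and x_i sgn(z_i) <=
    |x_i|; otherwise w_i = 0 and lam dominates |z_i|.\<close>
  have S_ge: "S x \<ge> - (x \<bullet> w)" for x
  proof -
    have "- (x $ i * w $ i) \<le> lam * \<bar>x $ i\<bar> - x $ i * z $ i" for i
    proof (cases "\<bar>z $ i\<bar> > lam")
      case True
      then have "w $ i = z $ i - lam * sgn (z $ i)"
        using lam by (auto simp: w sgn_if max_def)
      then have "x $ i * w $ i = x $ i * z $ i - lam * (x $ i * sgn (z $ i))"
        by (simp add: right_diff_distrib mult.left_commute)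
      moreover have "lam * (x $ i * sgn (z $ i)) \<le> lam * \<bar>x $ i\<bar>"
        using lam by (intro mult_left_mono) (auto simp: sgn_if)
      ultimately show ?thesis by linarith
    next
      case False
      have "x $ i * z $ i \<le> \<bar>x $ i\<bar> * \<bar>z $ i\<bar>"
        by (metis abs_ge_self abs_mult)
      also have "\<dots> \<le> \<bar>x $ i\<bar> * lam"
        using False by (intro mult_left_mono) auto
      finally show ?thesis using False by (simp add: w mult.commute)
    qed
    then have "(\<Sum>i\<in>UNIV. - (x $ i * w $ i)) \<le> S x"
      unfolding S_def by (rule sum_mono)
    then show ?thesis by (simp add: inner_vec_def sum_negf)
  qed
  \<comment> \<open>Write -(x . w) as -||x|| ||w|| plus the Cauchy-Schwarz gap, then complete the
    square in ||x||. Both excess terms are nonnegative.\<close>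
  have lower: "obj x \<ge> m + (norm x - (norm w + lam))\<^sup>2 / 2 + (norm x * norm w - x \<bullet> w)" for x
    using S_ge[of x] unfolding obj m_def
    by (simp add: power2_eq_square algebra_simps add_divide_distrib diff_divide_distrib)
  have c0: "c > 0" using lam nw by (simp add: c_def add_pos_nonneg)
  have ncw: "norm (c *\<^sub>R w) = norm w + lam"
    using c0 nw by (simp add: c_def field_simps)
  have attained: "obj (c *\<^sub>R w) = m"
  proof -
    \<comment> \<open>The bound \<open>S_ge\<close> is tight here: where w_i is nonzero it has the
      sign of z_i and modulus |z_i| - lam, and c > 0 preserves the sign.\<close>
    have "lam * \<bar>(c *\<^sub>R w) $ i\<bar> - (c *\<^sub>R w) $ i * z $ i = - (c * (w $ i * w $ i))" for i
      using c0 by (auto simp: w abs_mult sgn_if max_def algebra_simps)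
    then have "S (c *\<^sub>R w) = - (c * (norm w)\<^sup>2)"
      by (simp add: S_def power2_norm_eq_inner inner_vec_def sum_negf sum_distrib_left)
    moreover have "c * (norm w)\<^sup>2 = (norm w + lam) * norm w"
      using nw by (simp add: c_def power2_eq_square field_simps)
    ultimately show ?thesis
      unfolding obj ncw m_def by (simp add: power2_eq_square algebra_simps)
  qed
  \<comment> \<open>A value not above \<open>m\<close> makes both excess terms vanish: the square
    fixes the length of x, equality in Cauchy-Schwarz its direction.\<close>
  have "x = c *\<^sub>R w" if "obj x \<le> m" for x
  proof -
    have cs: "norm x * norm w - x \<bullet> w \<ge> 0"
      using norm_cauchy_schwarz[of x w] by simp
    then have "(norm x - (norm w + lam))\<^sup>2 \<le> 0"
      using lower[of x] that by linarith
    then have nx: "norm x = norm w + lam" by simp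
    have "x \<bullet> w = norm x * norm w"
      using lower[of x] that cs nx by simp
    then have "norm x *\<^sub>R w = norm w *\<^sub>R x"
      by (simp add: norm_cauchy_schwarz_eq)
    moreover have "norm x = norm w * c"
      using nw nx by (simp add: c_def field_simps)
    ultimately have "norm w *\<^sub>R x = norm w *\<^sub>R (c *\<^sub>R w)"
      by simp
    then show ?thesis using nw by (metis less_irrefl scaleR_left_imp_eq)
  qed
  moreover have "m \<le> obj x" for x
    using lower[of x] norm_cauchy_schwarz[of x w] zero_le_power2[of "norm x - (norm w + lam)"]
    by linarith
  ultimately have "prox (\<lambda>x. lam * norm12 x) z = {c *\<^sub>R w}"
    unfolding set_eq_iff mem_prox_iff obj_def[symmetric] singleton_iff
    using attained by metis
  then show ?thesis by (simp add: c_def)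
qed

text \<open>The objective exceeds its minimum by three nonnegative terms: a square, an alignment
  defect, and lam - |z_j| times the gap between the two norms. The three conditions say that each
  one vanishes; at lam = |z_j| the norm gap is unrestricted.\<close>

lemma prox_norm12_small_iff:
  fixes z :: "real ^ 'd"
  assumes j: "j \<in> argmax_abs z" and le: "\<bar>z $ j\<bar> \<le> lam"
  shows "x \<in> prox (\<lambda>x. lam * norm12 x) z \<longleftrightarrow>
    norm x = \<bar>z $ j\<bar> \<and> (\<forall>i. x $ i * z $ i = \<bar>z $ j\<bar> * \<bar>x $ i\<bar>) \<and>
    (lam = \<bar>z $ j\<bar> \<or> norm1 x = norm x)"
proof -
  define M where "M = \<bar>z $ j\<bar>"
  \<comment> \<open>The alignment defect is measured with the largest modulus \<open>M\<close>
    instead of \<open>lam\<close>, so that it can vanish at a nonzero x even when M < lam.\<close>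
  define T where "T x = (\<Sum>i\<in>UNIV. M * \<bar>x $ i\<bar> - x $ i * z $ i)" for x :: "real ^ 'd"
  define obj where "obj x = 1/2 * (norm (x - z))\<^sup>2 + lam * norm12 x" for x
  define m where "m = (norm z)\<^sup>2 / 2 - M\<^sup>2 / 2"
  have M: "\<bar>z $ i\<bar> \<le> M" for i using j by (simp add: M_def mem_argmax_abs_iff)
  have separable: "(\<Sum>i\<in>UNIV. lam * \<bar>x $ i\<bar> - x $ i * z $ i) = (lam - M) * norm1 x + T x" for x
    unfolding T_def norm1_def sum_distrib_left sum.distrib[symmetric]
    by (simp add: algebra_simps)
  \<comment> \<open>Split -lam ||x|| into -M ||x||, which completes the square, and -(lam - M)
    ||x||, which pairs with the 1-norm.\<close>
  have obj: "obj x = m + (norm x - M)\<^sup>2 / 2 + T x + (lam - M) * (norm1 x - norm x)" for x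
    unfolding obj_def prox_objective_expand m_def separable
    by (simp add: power2_eq_square algebra_simps add_divide_distrib diff_divide_distrib)
  have T_term: "x $ i * z $ i \<le> M * \<bar>x $ i\<bar>" for x i
  proof -
    have "x $ i * z $ i \<le> \<bar>z $ i\<bar> * \<bar>x $ i\<bar>"
      by (metis abs_ge_self abs_mult mult.commute)
    also have "\<dots> \<le> M * \<bar>x $ i\<bar>" by (intro mult_right_mono M) auto
    finally show ?thesis .
  qed
  have T_nonneg: "T x \<ge> 0" for x
    unfolding T_def by (simp add: sum_nonneg T_term)
  have T_zero: "T x = 0 \<longleftrightarrow> (\<forall>i. x $ i * z $ i = M * \<bar>x $ i\<bar>)" for x
    unfolding T_def by (subst sum_nonneg_eq_0_iff) (auto simp: T_term)
  have U_nonneg: "(lam - M) * (norm1 x - norm x) \<ge> 0" for x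
    using le norm_le_norm1[of x] by (simp add: M_def)
  have lower: "m \<le> obj x" for x
    unfolding obj using T_nonneg[of x] U_nonneg[of x] by simp
  \<comment> \<open>All three terms vanish at \<open>keep_coord z j\<close>, so the lower bound
    \<open>m\<close> is the minimum value.\<close>
  have "T (keep_coord z j) = 0"
    by (auto simp: T_zero keep_coord_def M_def simp flip: abs_mult)
  moreover have "norm (keep_coord z j) = M"
    by (simp add: norm_keep_coord M_def)
  moreover have "norm1 (keep_coord z j) = M"
    by (simp add: norm1_keep_coord M_def)
  ultimately have "obj (keep_coord z j) = m" by (simp add: obj)
  then have "x \<in> prox (\<lambda>x. lam * norm12 x) z \<longleftrightarrow> obj x = m"
    unfolding mem_prox_iff obj_def[symmetric] using lower by (metis antisym)
  also have "\<dots> \<longleftrightarrow> (norm x - M)\<^sup>2 = 0 \<and> T x = 0 \<and> (lam - M) * (norm1 x - norm x) = 0"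
    unfolding obj using T_nonneg[of x] U_nonneg[of x] zero_le_power2[of "norm x - M"] by linarith
  finally show ?thesis by (auto simp: T_zero M_def)
qed

lemma keep_coord_mem_prox_norm12:
  assumes "j \<in> argmax_abs z" and "\<bar>z $ j\<bar> \<le> lam"
  shows "keep_coord z j \<in> prox (\<lambda>x. lam * norm12 x) z"
  unfolding prox_norm12_small_iff[OF assms]
  by (auto simp: norm_keep_coord norm1_keep_coord) (auto simp: keep_coord_def simp flip: abs_mult)

text \<open>Alignment confines the support of a minimizer to argmax coordinates; what remains is
  that the support is a single point. Below the threshold this comes from equality of the norms, at
  the threshold from uniqueness of the argmax.\<close>

lemma prox_norm12_small_imp_keep_coord:
  fixes z :: "real ^ 'd"
  assumes small: "\<And>i. \<bar>z $ i\<bar> \<le> lam"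
    and uniq: "lam > 0 \<and> (\<exists>i. \<bar>z $ i\<bar> = lam) \<longrightarrow> (\<exists>!j. j \<in> argmax_abs z)"
    and x: "x \<in> prox (\<lambda>x. lam * norm12 x) z"
  shows "\<exists>j\<in>argmax_abs z. x = keep_coord z j"
proof -
  obtain j where j: "j \<in> argmax_abs z" using argmax_abs_nonempty by blast
  have nx: "norm x = \<bar>z $ j\<bar>" and xz: "\<And>i. x $ i * z $ i = \<bar>z $ j\<bar> * \<bar>x $ i\<bar>"
    and alt: "lam = \<bar>z $ j\<bar> \<or> norm1 x = norm x"
    using x unfolding prox_norm12_small_iff[OF j small] by auto
  show ?thesis
  \<comment> \<open>If the maximum is 0, then x = 0. Otherwise lam > 0, as \<open>uniq\<close>
    asks.\<close>
  proof (cases "z $ j = 0")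
    case True
    then have "x = keep_coord z j" using nx by (simp add: keep_coord_def vec_eq_iff)
    then show ?thesis using j by blast
  next
    case False
    have supp: "\<bar>z $ i\<bar> = \<bar>z $ j\<bar>" if "x $ i \<noteq> 0" for i
    proof -
      have "\<bar>x $ i\<bar> * \<bar>z $ i\<bar> = \<bar>x $ i\<bar> * \<bar>z $ j\<bar>"
        using arg_cong[OF xz[of i], of abs] by (simp add: abs_mult mult.commute)
      then show ?thesis using that by simp
    qed
    have supp_argmax: "i \<in> argmax_abs z" if "x $ i \<noteq> 0" for i
      using supp[OF that] j by (simp add: mem_argmax_abs_iff)
    have "x \<noteq> 0" using nx False by auto
    then obtain i where i: "x $ i \<noteq> 0" by (auto simp: vec_eq_iff)
    have single: "x $ k = 0" if "k \<noteq> i" for k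
      using alt
    proof
      assume "lam = \<bar>z $ j\<bar>"
      then have "\<exists>!j. j \<in> argmax_abs z" using uniq False by auto
      then show ?thesis using supp_argmax i that by blast
    next
      assume "norm1 x = norm x"
      then show ?thesis using i that by (rule norm1_eq_norm_imp_single_coordinate)
    qed
    then have x_axis: "x = axis i (x $ i)" by (simp add: vec_eq_iff axis_def)
    then have "\<bar>x $ i\<bar> = \<bar>z $ i\<bar>" using nx supp[OF i] norm_axis by metis
    moreover have "x $ i * z $ i = \<bar>z $ i\<bar> * \<bar>x $ i\<bar>" using xz[of i] supp[OF i] by simp
    \<comment> \<open>Equal moduli and a positive product exclude opposite signs.\<close>
    ultimately have "x $ i = z $ i" using i by (auto simp: abs_if split: if_splits)
    then have "x = keep_coord z i" using x_axis by (simp add: keep_coord_eq_axis)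
    then show ?thesis using supp_argmax[OF i] by blast
  qed
qed

text \<open>Ties at the threshold are the reason for the extra condition when w = 0: for z = (1,1)
  and lam = 1, every unit vector with nonnegative entries is a minimizer. Ties below the threshold
  only give several minimizers of the form \<open>keep_coord z j\<close>.\<close>

theorem mainTheorem1:
  fixes z w :: "real ^ 'd" and lam :: real
  assumes "lam \<ge> 0"
    and "w = (\<chi> i. sgn (z $ i) * max (\<bar>z $ i\<bar> - lam) 0)"
  shows "(w = 0 \<longrightarrow>
            (\<forall>j\<in>argmax_abs z. keep_coord z j \<in> prox (\<lambda>x. lam * norm12 x) z) \<and>
            ((lam > 0 \<and> (\<exists>i. \<bar>z $ i\<bar> = lam) \<longrightarrow> (\<exists>!j. j \<in> argmax_abs z)) \<longrightarrow>
              (\<forall>x\<in>prox (\<lambda>x. lam * norm12 x) z. \<exists>j\<in>argmax_abs z. x = keep_coord z j))) \<and>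
         (w \<noteq> 0 \<longrightarrow>
            prox (\<lambda>x. lam * norm12 x) z = {(1 + lam / norm w) *\<^sub>R w})"
proof (intro conjI impI)
  assume "w = 0"
  have small: "\<bar>z $ i\<bar> \<le> lam" for i
  proof -
    have "w $ i = 0" using \<open>w = 0\<close> by simp
    then show ?thesis using assms(1) by (auto simp: assms(2) sgn_zero_iff max_def split: if_splits)
  qed
  show "\<forall>j\<in>argmax_abs z. keep_coord z j \<in> prox (\<lambda>x. lam * norm12 x) z"
    using keep_coord_mem_prox_norm12 small by blast
  assume "lam > 0 \<and> (\<exists>i. \<bar>z $ i\<bar> = lam) \<longrightarrow> (\<exists>!j. j \<in> argmax_abs z)"
  then show "\<forall>x\<in>prox (\<lambda>x. lam * norm12 x) z. \<exists>j\<in>argmax_abs z. x = keep_coord z j"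
    using prox_norm12_small_imp_keep_coord small by blast
next
  assume "w \<noteq> 0"
  then show "prox (\<lambda>x. lam * norm12 x) z = {(1 + lam / norm w) *\<^sub>R w}"
    using assms by (intro prox_norm12_large)
qed

end
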